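(* For every positive integer $n$, the number of $3$-$\underline{5}$-$2$-$4$-$1$-satisfying permutations on $[n]$ is equal to the number of $31$-$4$-$2$-avoiding permutations on $[n]$.
   Context: Let $[n]=\{1,2,\dots,n\}$. A permutation on $[n]$ is regarded as a list $\pi=\pi_1\pi_2\cdots\pi_n$ containing each element of $[n]$ exactly once. The reduced form of a list of distinct integers is obtained by replacing its smallest entry by $1$, its next smallest by $2$, and so on. In a dashed pattern, the absence of a dash between two letters means that the corresponding entries must be adjacent in the permutation; a dash means that no adjacency is required. Sublists are not necessarily contiguous, but their entries appear in the order in which they occur in $\pi$. An instance of $31$-$4$-$2$ in $\pi$ is a sublist $\pi_i\pi_{i+1}\pi_j\pi_k$ with $i+1<j<k$ whose reduced form is $3142$ (i.e. $\pi_{i+1}<\pi_k<\pi_i<\pi_j$), so the first two entries are consecutive entries of $\pi$. The permutation $\pi$ is $31$-$4$-$2$-avoiding if it contains no such instance. An instance of $3$-$2$-$4$-$1$ in $\pi$ is a sublist $\pi_a\pi_b\pi_c\pi_d$ with $a<b<c<d$ whose reduced form is $3241$ (i.e. $\pi_d<\pi_b<\pi_a<\pi_c$). The permutation $\pi$ is $3$-$\underline{5}$-$2$-$4$-$1$-satisfying if it contains a $3$-$2$-$4$-$1$ pattern only as part of a $3$-$5$-$2$-$4$-$1$ pattern. That is, for every instance $\pi_a\pi_b\pi_c\pi_d$ of $3$-$2$-$4$-$1$ in $\pi$ there is an index $e$ with $a<e<b$ such that $\pi_a\pi_e\pi_b\pi_c\pi_d$ has reduced form $35241$ (i.e. $\pi_e>\pi_c$).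 *)

theory Defs
  imports "HOL-Combinatorics.Multiset_Permutations"
begin

text \<open>
  A permutation on \<open>[n]\<close> is a list in \<^term>\<open>permutations_of_set {1..n}\<close>. Positions in lists are
  counted from 0, whereas the entries are \<open>1, \<dots>, n\<close>.
\<close>

text \<open>Each entry is replaced by its rank, the smallest entry having rank 1; this is the reduced form
  only for lists of distinct entries.\<close>

definition reduced_form :: "nat list \<Rightarrow> nat list" where
  "reduced_form xs = map (\<lambda>x. card {y \<in> set xs. y \<le> x}) xs"

definition instance_31_4_2 :: "nat list \<Rightarrow> nat \<Rightarrow> nat \<Rightarrow> nat \<Rightarrow> bool" where
  "instance_31_4_2 p i j k \<longleftrightarrow>
     i + 1 < j \<and> j < k \<and> k < length p \<and>
     reduced_form [p ! i, p ! (i + 1), p ! j, p ! k] = [3, 1, 4, 2]"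

definition avoiding_31_4_2 :: "nat list \<Rightarrow> bool" where
  "avoiding_31_4_2 p \<longleftrightarrow> \<not> (\<exists>i j k. instance_31_4_2 p i j k)"

definition instance_3_2_4_1 :: "nat list \<Rightarrow> nat \<Rightarrow> nat \<Rightarrow> nat \<Rightarrow> nat \<Rightarrow> bool" where
  "instance_3_2_4_1 p a b c d \<longleftrightarrow>
     a < b \<and> b < c \<and> c < d \<and> d < length p \<and>
     reduced_form [p ! a, p ! b, p ! c, p ! d] = [3, 2, 4, 1]"

text \<open>The \<open>5\<close> is the underlined letter of the pattern.\<close>

definition satisfying_3_5_2_4_1 :: "nat list \<Rightarrow> bool" where
  "satisfying_3_5_2_4_1 p \<longleftrightarrow>
     (\<forall>a b c d. instance_3_2_4_1 p a b c d \<longrightarrow>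
        (\<exists>e. a < e \<and> e < b \<and>
           reduced_form [p ! a, p ! e, p ! b, p ! c, p ! d] = [3, 5, 2, 4, 1]))"

end

theory Submission
  imports Defs
begin

text \<open>
  Both classes obey one recursion, obtained by cutting a permutation at its largest entry,
  \<open>p = L @ n # R\<close>. In an instance of either pattern this entry can only be the letter \<open>4\<close>, or the
  underlined \<open>5\<close>; so \<open>p\<close> is in the class iff \<open>L\<close> and \<open>R\<close> are and \<open>L\<close> is compatible with the values
  placed in \<open>R\<close>. For 31-4-2, no \<open>r\<close> in \<open>R\<close> may lie between the two entries of a descent
  of \<open>L\<close>; it is the same to say that no \<open>r\<close> lies between the entries of an inversion of \<open>L\<close>
  (lemma \<open>descent_across_iff_inversion\<close>). For 3-\<open>5\<close>-2-4-1, no inversion of \<open>L\<close> may lie entirely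
  above an \<open>r\<close> in \<open>R\<close>, since \<open>n\<close> would then play the \<open>4\<close> and nothing exceeds it; conversely, an
  instance that starts in \<open>L\<close> and continues in \<open>R\<close> is repaired by \<open>n\<close> itself.

  In both cases the condition concerns only the gap between consecutive values of \<open>L\<close> into which \<open>r\<close>
  falls: it must be one of the \<open>slots\<close> of \<open>L\<close>. The slots are the gaps not crossed by an inversion in
  the first class, and the gaps above the lower entry of every inversion in the second. Given \<open>L\<close>
  with \<open>s\<close> slots, the number of ways to choose \<open>j\<close> values for \<open>R\<close> is the number of multisets of
  \<open>j\<close> slots, a binomial coefficient in \<open>s\<close> and \<open>j\<close> (\<open>card_subsets_by_gaps\<close>).

  What makes the recursion close is that the number of slots of \<open>p\<close> is determined in the same manner.
  In the first class the slots of \<open>p\<close> are the gap above \<open>n\<close> and those slots of \<open>L\<close> that are at or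
  below the slots used by \<open>R\<close>; in the second they are the gap above \<open>n\<close> and those slots of \<open>L\<close> that
  are at or above the slots used by \<open>R\<close> (\<open>uncrossed_gaps_split\<close>, \<open>gaps_above_inversions_split\<close>).
  The two descriptions differ only by reversing the order of the slots, which does not affect counting.
  The locale \<open>split_at_max\<close> states this common structure, with the order of the slots as a
  parameter. By induction on the length, the number of slots has the same distribution
  in any two classes with this structure (\<open>count_with_unique\<close>), and so the classes are equinumerous.
\<close>

section \<open>Ranks, inversions and order isomorphism\<close>

text \<open>Read as a gap, \<open>rank_in A r\<close> numbers, from the bottom, the gap between consecutive elements of
  \<open>A\<close> into which \<open>r\<close> falls; for \<open>r \<in> A\<close> it is the gap just below \<open>r\<close>.\<close>

definition rank_in :: "nat set \<Rightarrow> nat \<Rightarrow> nat" where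
  "rank_in A x = card {y \<in> A. y < x}"

lemma rank_in_mono: "finite A \<Longrightarrow> x \<le> y \<Longrightarrow> rank_in A x \<le> rank_in A y"
  unfolding rank_in_def by (intro card_mono) auto

lemma rank_in_less_iff:
  assumes "finite A" "x \<in> A"
  shows "rank_in A x < rank_in A y \<longleftrightarrow> x < y"
proof
  assume "x < y"
  then have "{w \<in> A. w < x} \<subset> {w \<in> A. w < y}" using assms by auto
  then show "rank_in A x < rank_in A y"
    unfolding rank_in_def using assms by (intro psubset_card_mono) auto
next
  assume "rank_in A x < rank_in A y"
  then show "x < y" using rank_in_mono[OF assms(1), of y x] by (meson leD leI)
qed

lemma rank_in_le_card: "finite A \<Longrightarrow> rank_in A x \<le> card A"
  unfolding rank_in_def by (intro card_mono) auto

lemma rank_in_less_card: "finite A \<Longrightarrow> x \<in> A \<Longrightarrow> rank_in A x < card A"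
  unfolding rank_in_def by (intro psubset_card_mono) auto

lemma rank_in_Un:
  "finite A \<Longrightarrow> finite B \<Longrightarrow> A \<inter> B = {} \<Longrightarrow> rank_in (A \<union> B) x = rank_in A x + rank_in B x"
  unfolding rank_in_def by (subst card_Un_disjoint[symmetric]) (auto intro: arg_cong[of _ _ card])

lemma rank_in_image:
  assumes "strict_mono_on A f" "x \<in> A"
  shows "rank_in (f ` A) (f x) = rank_in A x"
proof -
  have "{y \<in> f ` A. y < f x} = f ` {y \<in> A. y < x}"
    using assms by (auto simp: strict_mono_on_less)
  moreover have "inj_on f {y \<in> A. y < x}"
    using strict_mono_on_imp_inj_on[OF assms(1)] by (rule inj_on_subset) auto
  ultimately show ?thesis by (simp add: rank_in_def card_image)
qed

text \<open>Inversions are kept as pairs of values, larger value first, because gaps are compared with values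
  and not with positions.\<close>

fun inversions :: "nat list \<Rightarrow> (nat \<times> nat) set" where
  "inversions [] = {}"
| "inversions (x # xs) = {(x, y) | y. y \<in> set xs \<and> y < x} \<union> inversions xs"

lemma inversions_append:
  "inversions (xs @ ys) = inversions xs \<union> inversions ys \<union>
     {(x, y). x \<in> set xs \<and> y \<in> set ys \<and> y < x}"
  by (induction xs) auto

lemma inversions_in_set: "(x, y) \<in> inversions xs \<Longrightarrow> x \<in> set xs \<and> y \<in> set xs"
  by (induction xs) auto

lemma inversions_map:
  assumes "strict_mono_on (set xs) f"
  shows "inversions (map f xs) = map_prod f f ` inversions xs"
  using assms
proof (induction xs)
  case (Cons x xs)
  have "strict_mono_on (set xs) f" using Cons.prems by (auto simp: strict_mono_on_def)
  then have IH: "inversions (map f xs) = map_prod f f ` inversions xs" by (rule Cons.IH)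
  have "{(f x, y) | y. y \<in> set (map f xs) \<and> y < f x}
      = map_prod f f ` {(x, y) | y. y \<in> set xs \<and> y < x}"
    using strict_mono_on_less[OF Cons.prems] by (force simp: image_iff)
  then show ?case by (simp add: IH image_Un)
qed simp

lemma inversions_nth:
  "(x, y) \<in> inversions xs \<longleftrightarrow>
     (\<exists>p q. p < q \<and> q < length xs \<and> xs ! p = x \<and> xs ! q = y \<and> y < x)"
proof (induction xs)
  case (Cons a xs)
  have "(\<exists>p q. p < q \<and> q < length (a # xs) \<and> (a # xs) ! p = x \<and> (a # xs) ! q = y \<and> y < x) \<longleftrightarrow>
      (\<exists>q. q < length xs \<and> a = x \<and> xs ! q = y \<and> y < x) \<or>
      (\<exists>p q. p < q \<and> q < length xs \<and> xs ! p = x \<and> xs ! q = y \<and> y < x)" (is "?l \<longleftrightarrow> ?r")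
  proof
    assume ?l
    then obtain p q where pq: "p < q" "q < length (a # xs)" "(a # xs) ! p = x"
      "(a # xs) ! q = y" "y < x" by blast
    then obtain q' where "q = Suc q'" by (cases q) auto
    with pq show ?r by (cases p) auto
  next
    assume ?r
    then show ?l
    proof
      assume "\<exists>q. q < length xs \<and> a = x \<and> xs ! q = y \<and> y < x"
      then obtain q where "q < length xs \<and> a = x \<and> xs ! q = y \<and> y < x" by blast
      then show ?l by (intro exI[of _ 0] exI[of _ "Suc q"]) auto
    next
      assume "\<exists>p q. p < q \<and> q < length xs \<and> xs ! p = x \<and> xs ! q = y \<and> y < x"
      then obtain p q where "p < q \<and> q < length xs \<and> xs ! p = x \<and> xs ! q = y \<and> y < x" by blast
      then show ?l by (intro exI[of _ "Suc p"] exI[of _ "Suc q"]) auto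
    qed
  qed
  moreover have "(x, y) \<in> inversions (a # xs) \<longleftrightarrow>
      (\<exists>q. q < length xs \<and> a = x \<and> xs ! q = y \<and> y < x) \<or> (x, y) \<in> inversions xs"
    by (auto simp: in_set_conv_nth)
  ultimately show ?case using Cons.IH by blast
qed simp

text \<open>Replacing the entries by their ranks preserves every property that depends only on the relative
  order of the entries.\<close>

lemma card_permutations_standardize:
  assumes "finite A"
    and inv: "\<And>f xs. strict_mono_on (set xs) f \<Longrightarrow> P (map f xs) \<longleftrightarrow> P xs"
  shows "card {xs \<in> permutations_of_set A. P xs} =
         card {xs \<in> permutations_of_set {..<card A}. P xs}"
proof -
  define f where "f = (\<lambda>i. sorted_list_of_set A ! i)"
  have smono: "strict_mono_on {..<card A} f"
    unfolding f_def
    by (rule strict_mono_onI) (simp add: sorted_wrt_nth_less[OF strict_sorted_list_of_set])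
  have img: "f ` {..<card A} = A"
    using nth_image[of "card A" "sorted_list_of_set A"] assms(1)
    by (simp add: f_def lessThan_atLeast0)
  have inj: "inj_on f {..<card A}" using smono by (rule strict_mono_on_imp_inj_on)
  have "bij_betw (map f) {xs \<in> permutations_of_set {..<card A}. P xs}
          {xs \<in> permutations_of_set A. P xs}"
  proof (rule bij_betw_imageI)
    show "inj_on (map f) {xs \<in> permutations_of_set {..<card A}. P xs}"
    proof (rule inj_onI)
      fix xs ys assume "xs \<in> {xs \<in> permutations_of_set {..<card A}. P xs}"
        "ys \<in> {xs \<in> permutations_of_set {..<card A}. P xs}" and eq: "map f xs = map f ys"
      then have "set xs \<union> set ys = {..<card A}" by (simp add: permutations_of_set_def)
      then show "xs = ys" using map_inj_on[OF eq] inj by simp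
    qed
    have im: "map f ` permutations_of_set {..<card A} = permutations_of_set A"
      using permutations_of_set_image_inj[OF inj] img by simp
    have "P (map f xs) \<longleftrightarrow> P xs" if "xs \<in> permutations_of_set {..<card A}" for xs
      using inv[of xs f] smono that by (simp add: permutations_of_set_def)
    then show "map f ` {xs \<in> permutations_of_set {..<card A}. P xs} =
        {xs \<in> permutations_of_set A. P xs}"
      unfolding im[symmetric] by auto
  qed
  then show ?thesis by (rule bij_betw_same_card[symmetric])
qed

section \<open>Placing the values to the right of the maximum\<close>

text \<open>Here \<open>B\<close> is the set of values to the right of the maximum, and its complement in
  \<open>{..<k + j}\<close> the set of the \<open>k\<close> values to the left. A set \<open>B\<close> amounts to the multiset of
  the gaps into which its elements fall, hence the number of multisets of size \<open>j\<close> over \<open>S\<close>. For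
  \<open>S = {}\<close> the truncated subtraction yields \<open>1\<close> if \<open>j = 0\<close> and \<open>0\<close> otherwise, as it should. The
  induction decides whether the largest value \<open>N\<close> belongs to \<open>B\<close>, in which case it falls into
  the top gap \<open>k\<close>, and leads to Pascal's rule.\<close>

lemma card_subsets_by_gaps:
  assumes "S \<subseteq> {..k}"
  shows "card {B. B \<subseteq> {..<k + j} \<and> card B = j \<and> (\<forall>r\<in>B. card ({..<r} - B) \<in> S)} =
         (card S + j - 1) choose j"
proof -
  define W where "W N j S = {B. B \<subseteq> {..<N} \<and> card B = j \<and> (\<forall>r\<in>B. card ({..<r} - B) \<in> S)}"
    for N j :: nat and S :: "nat set"
  have finW: "finite (W N j S)" for N j S
    by (rule finite_subset[of _ "Pow {..<N}"]) (auto simp: W_def)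
  have W0: "card (W N 0 S) = 1" for N S
  proof -
    have "W N 0 S = {{}}" by (auto simp: W_def dest: finite_subset)
    then show ?thesis by simp
  qed
  have "card (W N j S) = (card S + j - 1) choose j" if "N = k + j" "S \<subseteq> {..k}" for N k j S
    using that
  proof (induction N arbitrary: k j S)
    case 0
    then show ?case by (simp add: W0)
  next
    case (Suc N)
    show ?case
    proof (cases j)
      case 0
      then show ?thesis by (simp add: W0)
    next
      case j: (Suc j')
      have finS: "finite S" using Suc.prems(2) finite_subset by blast
      have ins: "insert N B \<in> W (Suc N) j S \<longleftrightarrow> B \<in> W N j' S \<and> k \<in> S" if "B \<subseteq> {..<N}" for B
      proof -
        have fB: "finite B" "N \<notin> B" using that finite_subset by auto
        have "{..<r} - insert N B = {..<r} - B" if "r \<le> N" for r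
          using that by auto
        moreover from this have "card ({..<r} - insert N B) = card ({..<r} - B)" if "r \<in> B" for r
          using that \<open>B \<subseteq> {..<N}\<close> by (metis lessThan_iff less_imp_le subsetD)
        ultimately have "(\<forall>r\<in>insert N B. card ({..<r} - insert N B) \<in> S) \<longleftrightarrow>
            card ({..<N} - B) \<in> S \<and> (\<forall>r\<in>B. card ({..<r} - B) \<in> S)"
          by simp
        moreover have "card ({..<N} - B) = N - card B"
          using that fB by (simp add: card_Diff_subset)
        ultimately show ?thesis
          using fB that Suc.prems(1) j
          by (auto simp: W_def)
      qed
      have split: "W (Suc N) j S = (if k \<in> S then insert N ` W N j' S else {}) \<union> W N j S"
      proof (intro equalityI subsetI)
        fix B assume B: "B \<in> W (Suc N) j S"
        show "B \<in> (if k \<in> S then insert N ` W N j' S else {}) \<union> W N j S"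
        proof (cases "N \<in> B")
          case True
          then have eq: "B = insert N (B - {N})" by auto
          moreover have sub: "B - {N} \<subseteq> {..<N}" using B by (auto simp: W_def less_Suc_eq)
          ultimately have mem: "B - {N} \<in> W N j' S \<and> k \<in> S" using ins[OF sub] B by metis
          then have "B \<in> insert N ` W N j' S" by (intro image_eqI[where f = "insert N", OF eq]) simp
          then show ?thesis using mem by simp
        next
          case False
          then have "B \<subseteq> {..<N}" using B by (auto simp: W_def less_Suc_eq)
          then show ?thesis using B by (auto simp: W_def)
        qed
      next
        fix B assume "B \<in> (if k \<in> S then insert N ` W N j' S else {}) \<union> W N j S"
        then consider B' where "k \<in> S" "B' \<in> W N j' S" "B = insert N B'" | "B \<in> W N j S"
          by (auto split: if_splits)
        then show "B \<in> W (Suc N) j S"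
        proof cases
          case 1
          moreover from this have "B' \<subseteq> {..<N}" by (simp add: W_def)
          ultimately show ?thesis using ins by blast
        next
          case 2
          then show ?thesis by (auto simp: W_def less_Suc_eq)
        qed
      qed
      have c1: "card (insert N ` W N j' S) = (card S + j' - 1) choose j'"
      proof -
        have "inj_on (insert N) (W N j' S)"
        proof (rule inj_onI)
          fix B B' assume "B \<in> W N j' S" "B' \<in> W N j' S" and eq: "insert N B = insert N B'"
          then have "N \<notin> B" "N \<notin> B'" by (auto simp: W_def)
          then show "B = B'" using eq by (simp add: insert_ident)
        qed
        then have "card (insert N ` W N j' S) = card (W N j' S)" by (rule card_image)
        also have "\<dots> = (card S + j' - 1) choose j'"
          using Suc.IH[of k j' S] Suc.prems j by auto
        finally show ?thesis .
      qed
      have c2: "card (W N j S) = (if k = 0 then 0 else (card (S - {k}) + j - 1) choose j)"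
      proof (cases k)
        case 0
        have "W N j S = {}"
        proof (rule ccontr)
          assume "W N j S \<noteq> {}"
          then obtain B where B: "B \<subseteq> {..<N}" "card B = j" by (auto simp: W_def)
          then have "j \<le> N" using card_mono[of "{..<N}" B] by simp
          then show False using Suc.prems(1) 0 by simp
        qed
        then show ?thesis using 0 by simp
      next
        case (Suc k')
        have N: "N = k' + j" using Suc.prems(1) Suc by simp
        have "card ({..<r} - B) \<noteq> k" if "B \<subseteq> {..<N}" "card B = j" "r \<in> B" for r B
        proof -
          have "card ({..<r} - B) \<le> card ({..<N} - B)"
            using that by (intro card_mono) auto
          also have "\<dots> = N - j" using that by (simp add: card_Diff_subset finite_subset)
          finally show ?thesis using N Suc by simp
        qed
        then have "W N j S = W N j (S - {k})" by (auto simp: W_def)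
        moreover have "S - {k} \<subseteq> {..k'}" using Suc.prems(2) Suc by (auto simp: subset_iff le_Suc_eq)
        ultimately show ?thesis using Suc.IH[OF N] Suc by simp
      qed
      have disj: "insert N ` W N j' S \<inter> W N j S = {}" by (auto simp: W_def)
      show ?thesis
      proof (cases "k \<in> S")
        case True
        then have S: "card S = Suc (card (S - {k}))"
          using card_Suc_Diff1[OF finS] by simp
        have "card (W (Suc N) j S) = ((card S + j' - 1) choose j') + card (W N j S)"
          unfolding split using True disj finW c1 by (simp add: card_Un_disjoint)
        then show ?thesis
        proof (cases "k = 0")
          case True
          then have "S = {0}" using Suc.prems(2) \<open>k \<in> S\<close> by auto
          then show ?thesis using c2 True \<open>card (W (Suc N) j S) = _\<close> j by simp
        qed (use S c2 j in simp)
      next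
        case False
        then have *: "card (W (Suc N) j S) = card (W N j S)" by (simp add: split)
        show ?thesis
        proof (cases "k = 0")
          case True
          then have "S = {}" using Suc.prems(2) False by auto
          then show ?thesis using * c2 True j by simp
        qed (use * c2 False in simp)
      qed
    qed
  qed
  from this[OF refl assms] show ?thesis by (simp add: W_def)
qed

lemma card_permutations_split_max:
  "card {p \<in> permutations_of_set {..<Suc n}. P p} =
   (\<Sum>B\<in>Pow {..<n}. card {(L, R). L \<in> permutations_of_set ({..<n} - B) \<and>
        R \<in> permutations_of_set B \<and> P (L @ n # R)})"
proof -
  define X where "X B = {(L, R). L \<in> permutations_of_set ({..<n} - B) \<and>
        R \<in> permutations_of_set B \<and> P (L @ n # R)}" for B
  define h where "h = (\<lambda>(B :: nat set, L, R). L @ n # R)"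
  have finX: "finite (X B)" if "B \<in> Pow {..<n}" for B
    by (rule finite_subset[of _ "permutations_of_set ({..<n} - B) \<times> permutations_of_set B"])
      (use that finite_subset in \<open>auto simp: X_def\<close>)
  have "bij_betw h (SIGMA B:Pow {..<n}. X B) {p \<in> permutations_of_set {..<Suc n}. P p}"
  proof (rule bij_betw_imageI)
    show "inj_on h (SIGMA B:Pow {..<n}. X B)"
    proof (rule inj_onI)
      fix u v
      assume u: "u \<in> (SIGMA B:Pow {..<n}. X B)" and v: "v \<in> (SIGMA B:Pow {..<n}. X B)"
        and eq: "h u = h v"
      obtain B L R where u': "u = (B, L, R)" by (cases u) auto
      obtain B' L' R' where v': "v = (B', L', R')" by (cases v) auto
      have "n \<notin> set L" "n \<notin> set R'" "n \<notin> set L'"  "n \<notin> set R" "set R = B" "set R' = B'"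
        using u v by (auto simp: u' v' X_def permutations_of_set_def)
      moreover from this have "L = L' \<and> R = R'"
        using eq by (auto simp: u' v' h_def append_eq_append_conv2 append_eq_Cons_conv Cons_eq_append_conv)
      ultimately show "u = v" by (simp add: u' v')
    qed
    show "h ` (SIGMA B:Pow {..<n}. X B) = {p \<in> permutations_of_set {..<Suc n}. P p}"
    proof (intro equalityI subsetI)
      fix p assume "p \<in> h ` (SIGMA B:Pow {..<n}. X B)"
      then show "p \<in> {p \<in> permutations_of_set {..<Suc n}. P p}"
        by (auto simp: h_def X_def permutations_of_set_def less_Suc_eq)
    next
      fix p assume p: "p \<in> {p \<in> permutations_of_set {..<Suc n}. P p}"
      then have "n \<in> set p" by (auto simp: permutations_of_set_def)
      then obtain L R where LR: "p = L @ n # R" by (meson split_list)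
      have "set L \<union> set R = {..<n}" "set L \<inter> set R = {}" "distinct L" "distinct R"
        using p by (auto simp: LR permutations_of_set_def set_eq_iff less_Suc_eq)
      then have "(set R, L, R) \<in> (SIGMA B:Pow {..<n}. X B)"
        using p by (auto simp: X_def permutations_of_set_def LR)
      then show "p \<in> h ` (SIGMA B:Pow {..<n}. X B)" 
        by (rule image_eqI[rotated]) (simp add: h_def LR)
    qed
  qed
  then have "card {p \<in> permutations_of_set {..<Suc n}. P p} = card (SIGMA B:Pow {..<n}. X B)"
    by (rule bij_betw_same_card[symmetric])
  also have "\<dots> = (\<Sum>B\<in>Pow {..<n}. card (X B))"
    by (rule card_SigmaI) (use finX in auto)
  finally show ?thesis by (simp add: X_def)
qed


section \<open>The recursion\<close>

text \<open>This lemma and the next are stated for abstract linear orders so that they apply to \<open>\<le>\<close> and to \<open>\<ge>\<close>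
  on the natural numbers.\<close>

lemma (in linorder) card_drop_lowest:
  "finite X \<Longrightarrow> card {x \<in> X. t \<le> card {y \<in> X. y < x}} = card X - t"
proof (induction X rule: finite_linorder_max_induct)
  case (insert b X)
  have "{y \<in> insert b X. y < x} = {y \<in> X. y < x}" if "x \<in> X" for x
    using insert.hyps(2) that by (auto dest: less_asym)
  moreover have "{y \<in> insert b X. y < b} = X" using insert.hyps(2) by auto
  moreover have "b \<notin> X" using insert.hyps(2) by auto
  ultimately have "{x \<in> insert b X. t \<le> card {y \<in> insert b X. y < x}} =
      (if t \<le> card X then {b} else {}) \<union> {x \<in> X. t \<le> card {y \<in> X. y < x}}"
    by auto
  then show ?case using insert.IH insert.hyps \<open>b \<notin> X\<close> by auto
qed simp

text \<open>If \<open>V\<close> is nonempty, its minimum belongs to \<open>X\<close> and is itself one of the counted elements; this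
  accounts for the strict inequality on the left against the weak one on the right. For
  empty \<open>V\<close> all of \<open>X\<close> is counted, whence the condition \<open>t < card X\<close>.\<close>

lemma (in linorder) less_card_below_all:
  assumes "finite X" "V \<subseteq> X"
  shows "t < card {x \<in> X. \<forall>v\<in>V. x \<le> v} \<longleftrightarrow>
    t < card X \<and> (\<forall>v\<in>V. t \<le> card {y \<in> X. y < v})"
proof (cases "V = {}")
  case False
  have fV: "finite V" using assms finite_subset by blast
  define v where "v = Min V"
  have v: "v \<in> V" "\<And>w. w \<in> V \<Longrightarrow> v \<le> w" using fV False by (auto simp: v_def)
  have "{x \<in> X. \<forall>v\<in>V. x \<le> v} = insert v {y \<in> X. y < v}"
    using v assms(2) by (auto intro: order_trans less_imp_le)
  then have c: "card {x \<in> X. \<forall>v\<in>V. x \<le> v} = Suc (card {y \<in> X. y < v})"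
    using assms(1) by simp
  have mono: "card {y \<in> X. y < v} \<le> card {y \<in> X. y < w}" if "w \<in> V" for w
    using v(2)[OF that] assms(1) by (intro card_mono) (auto intro: less_le_trans)
  have top: "card {y \<in> X. y < v} < card X"
    using v assms by (intro psubset_card_mono) auto
  show ?thesis
  proof
    assume "t < card {x \<in> X. \<forall>v\<in>V. x \<le> v}"
    then have "t \<le> card {y \<in> X. y < v}" by (simp add: c)
    then show "t < card X \<and> (\<forall>v\<in>V. t \<le> card {y \<in> X. y < v})"
      using top by (auto intro: Nat.le_trans[OF _ mono])
  next
    assume "t < card X \<and> (\<forall>v\<in>V. t \<le> card {y \<in> X. y < v})"
    then show "t < card {x \<in> X. \<forall>v\<in>V. x \<le> v}" using v(1) by (simp add: c less_Suc_eq_le)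
  qed
qed simp

definition count_with :: "(nat list \<Rightarrow> bool) \<Rightarrow> (nat list \<Rightarrow> nat set) \<Rightarrow> nat \<Rightarrow> nat \<Rightarrow> nat" where
  "count_with C slots t k =
     card {p \<in> permutations_of_set {..<k}. C p \<and> t \<le> card (slots p)}"

text \<open>The number of multisets of size \<open>j\<close> over the slots that remain after discarding \<open>t\<close> of \<open>s\<close>. It
  is \<open>0\<close> for \<open>s \<le> t\<close> even if \<open>j = 0\<close>, because \<open>split_iff\<close> requires more than \<open>t\<close> slots.\<close>

definition gap_choices :: "nat \<Rightarrow> nat \<Rightarrow> nat \<Rightarrow> nat" where
  "gap_choices t j s = (if t < s then (s - t + j - 1) choose j else 0)"

text \<open>The structure that the two classes have in common: \<open>C\<close> is the class, and \<open>slots L\<close> are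
  the gaps of \<open>L\<close> that may receive values of \<open>R\<close>. The order \<open>le\<close> of the gaps is \<open>\<le>\<close> for one class and
  \<open>\<ge>\<close> for the other; the slots of \<open>L\<close> that survive in \<open>L @ z # R\<close> are those that come, in this order,
  no later than any slot used by \<open>R\<close>, and the gap above \<open>z\<close> is an additional slot.\<close>

locale split_at_max =
  fixes le lt :: "nat \<Rightarrow> nat \<Rightarrow> bool"
    and C :: "nat list \<Rightarrow> bool" and slots :: "nat list \<Rightarrow> nat set"
  assumes order: "class.linorder le lt"
    and C_Nil: "C []"
    and C_map: "\<And>f xs. strict_mono_on (set xs) f \<Longrightarrow> C (map f xs) \<longleftrightarrow> C xs"
    and slots_map: "\<And>f xs. strict_mono_on (set xs) f \<Longrightarrow> slots (map f xs) = slots xs"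
    and slots_subset: "\<And>xs. slots xs \<subseteq> {..length xs}"
    and slots_nonempty: "\<And>xs. slots xs \<noteq> {}"
    and C_split: "\<And>L z R. distinct (L @ z # R) \<Longrightarrow> \<forall>x\<in>set L \<union> set R. x < z \<Longrightarrow>
      C (L @ z # R) \<longleftrightarrow> C L \<and> C R \<and> (\<forall>r\<in>set R. rank_in (set L) r \<in> slots L)"
    and card_slots_split: "\<And>L z R. distinct (L @ z # R) \<Longrightarrow> \<forall>x\<in>set L \<union> set R. x < z \<Longrightarrow>
      card (slots (L @ z # R)) =
        Suc (card {i \<in> slots L. \<forall>r\<in>set R. le i (rank_in (set L) r)})"
begin

lemma finite_slots: "finite (slots xs)"
  using slots_subset finite_subset by blast

definition later_slots :: "nat \<Rightarrow> nat list \<Rightarrow> nat set" where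
  "later_slots t xs = {i \<in> slots xs. t \<le> card {i' \<in> slots xs. lt i' i}}"

lemma card_later_slots: "card (later_slots t xs) = card (slots xs) - t"
  unfolding later_slots_def by (rule linorder.card_drop_lowest[OF order finite_slots])

text \<open>Counting permutations with at least a given number of slots, rather than exactly that number,
  turns the requirement on the number of slots into a restriction on where the
  values of \<open>R\<close> may go: the first \<open>t\<close> slots of \<open>L\<close> must stay unused.\<close>

lemma split_iff:
  assumes "distinct (L @ z # R)" "\<forall>x\<in>set L \<union> set R. x < z"
  shows "C (L @ z # R) \<and> Suc (Suc t) \<le> card (slots (L @ z # R)) \<longleftrightarrow>
    C L \<and> C R \<and> t < card (slots L) \<and> (\<forall>r\<in>set R. rank_in (set L) r \<in> later_slots t L)"
proof -
  have "t < card {i \<in> slots L. \<forall>r\<in>set R. le i (rank_in (set L) r)} \<longleftrightarrow>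
      t < card (slots L) \<and> (\<forall>r\<in>set R. t \<le> card {i \<in> slots L. lt i (rank_in (set L) r)})"
    if "\<forall>r\<in>set R. rank_in (set L) r \<in> slots L"
    using linorder.less_card_below_all[OF order finite_slots, of "rank_in (set L) ` set R" L t] that by auto
  then show ?thesis
    unfolding C_split[OF assms] card_slots_split[OF assms]
    by (auto simp: later_slots_def Suc_le_eq)
qed

lemma card_slots_ge_two:
  assumes "p \<in> permutations_of_set {..<Suc n}" "C p"
  shows "2 \<le> card (slots p)"
proof -
  have "n \<in> set p" using assms(1) by (auto simp: permutations_of_set_def)
  then obtain L R where p: "p = L @ n # R" by (meson split_list)
  have dist: "distinct (L @ n # R)" using assms(1) by (simp add: permutations_of_set_def p)
  have less: "\<forall>x\<in>set L \<union> set R. x < n"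
    using assms(1) by (auto simp: permutations_of_set_def p set_eq_iff less_Suc_eq)
  have "C L \<and> C R \<and> (\<forall>r\<in>set R. rank_in (set L) r \<in> slots L)"
    using assms(2) C_split[OF dist less] by (simp add: p)
  then have "\<forall>r\<in>set R. rank_in (set L) r \<in> later_slots 0 L"
    by (simp add: later_slots_def)
  moreover have "0 < card (slots L)"
    using finite_slots slots_nonempty by (simp add: card_gt_0_iff)
  ultimately show ?thesis using split_iff[OF dist less, of 0] \<open>C L \<and> _\<close> by (simp add: p)
qed

lemma count_with_Suc_less:
  assumes "t \<le> 1"
  shows "count_with C slots t (Suc n) = count_with C slots 2 (Suc n)"
proof -
  have "t \<le> card (slots p) \<longleftrightarrow> 2 \<le> card (slots p)"
    if "p \<in> permutations_of_set {..<Suc n}" "C p" for p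
    using card_slots_ge_two[OF that] assms by simp
  then have "{p \<in> permutations_of_set {..<Suc n}. C p \<and> t \<le> card (slots p)} =
      {p \<in> permutations_of_set {..<Suc n}. C p \<and> 2 \<le> card (slots p)}"
    by (intro Collect_cong conj_cong refl) simp_all
  then show ?thesis by (simp add: count_with_def)
qed

lemma count_with_0: "count_with C slots t 0 = (if t \<le> 1 then 1 else 0)"
proof -
  have "slots [] \<subseteq> {0}" using slots_subset[of "[]"] by simp
  then have "slots [] = {0}" by (rule subset_singletonD[THEN disjE]) (simp_all add: slots_nonempty)
  then have "C [] \<and> t \<le> card (slots []) \<longleftrightarrow> t \<le> 1" using C_Nil by simp
  moreover have "{p \<in> {[]}. C p \<and> t \<le> card (slots p)} =
      (if C [] \<and> t \<le> card (slots []) then {[]} else {})" by auto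
  ultimately show ?thesis unfolding count_with_def lessThan_0 permutations_of_set_empty by simp
qed

lemma card_split_pairs:
  assumes "B \<subseteq> {..<n}"
  shows "card {(L, R). L \<in> permutations_of_set ({..<n} - B) \<and> R \<in> permutations_of_set B \<and>
        C (L @ n # R) \<and> Suc (Suc t) \<le> card (slots (L @ n # R))} =
    card {s \<in> permutations_of_set {..<n - card B}. C s \<and> t < card (slots s) \<and>
        (\<forall>r\<in>B. card ({..<r} - B) \<in> later_slots t s)} * count_with C slots 0 (card B)"
proof -
  have finB: "finite B" using assms finite_subset by blast
  define Q where "Q L \<longleftrightarrow> C L \<and> t < card (slots L) \<and>
        (\<forall>r\<in>B. card ({..<r} - B) \<in> later_slots t L)" for L
  have "{(L, R). L \<in> permutations_of_set ({..<n} - B) \<and> R \<in> permutations_of_set B \<and>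
        C (L @ n # R) \<and> Suc (Suc t) \<le> card (slots (L @ n # R))} =
      {L \<in> permutations_of_set ({..<n} - B). Q L} \<times> {R \<in> permutations_of_set B. C R}"
  proof -
    have "C (L @ n # R) \<and> Suc (Suc t) \<le> card (slots (L @ n # R)) \<longleftrightarrow> Q L \<and> C R"
      if LR: "L \<in> permutations_of_set ({..<n} - B)" "R \<in> permutations_of_set B" for L R
    proof -
      have sets: "set L = {..<n} - B" "set R = B" "distinct L" "distinct R"
        using LR by (auto simp: permutations_of_set_def)
      have "{y \<in> {..<n} - B. y < r} = {..<r} - B" if "r \<in> B" for r
        using that assms by auto
      then have "rank_in (set L) r = card ({..<r} - B)" if "r \<in> B" for r
        using that by (simp add: rank_in_def sets)
      moreover have "distinct (L @ n # R)" using sets assms by auto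
      moreover have "\<forall>x\<in>set L \<union> set R. x < n" using sets assms by auto
      ultimately show ?thesis using split_iff[of L n R t] by (auto simp: Q_def sets)
    qed
    then show ?thesis by blast
  qed
  moreover have "card {L \<in> permutations_of_set ({..<n} - B). Q L} =
      card {s \<in> permutations_of_set {..<n - card B}. Q s}"
  proof -
    have "Q (map f xs) \<longleftrightarrow> Q xs" if "strict_mono_on (set xs) f" for f xs
      unfolding Q_def later_slots_def C_map[OF that] slots_map[OF that] ..
    then have "card {L \<in> permutations_of_set ({..<n} - B). Q L} =
        card {s \<in> permutations_of_set {..<card ({..<n} - B)}. Q s}"
      by (intro card_permutations_standardize) auto
    then show ?thesis using assms finB by (simp add: card_Diff_subset)
  qed
  moreover have "card {R \<in> permutations_of_set B. C R} = count_with C slots 0 (card B)"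
    using card_permutations_standardize[OF finB, of C] C_map by (simp add: count_with_def)
  ultimately show ?thesis by (simp add: card_cartesian_product Q_def)
qed

text \<open>Double counting of the compatible pairs \<open>(s, B)\<close>: for a fixed pattern \<open>s\<close> of the left part, the
  number of sets \<open>B\<close> depends on \<open>s\<close> only through its number of slots.\<close>

lemma sum_over_subsets_gaps:
  assumes "j \<le> n"
  shows "(\<Sum>B | B \<subseteq> {..<n} \<and> card B = j.
      card {s \<in> permutations_of_set {..<n - j}. C s \<and> t < card (slots s) \<and>
        (\<forall>r\<in>B. card ({..<r} - B) \<in> later_slots t s)}) =
    (\<Sum>s | s \<in> permutations_of_set {..<n - j} \<and> C s. gap_choices t j (card (slots s)))"
proof -
  define Bs where "Bs = {B. B \<subseteq> {..<n} \<and> card B = j}"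
  define P where "P = {s. s \<in> permutations_of_set {..<n - j} \<and> C s}"
  define Q where "Q s B \<longleftrightarrow> t < card (slots s) \<and>
        (\<forall>r\<in>B. card ({..<r} - B) \<in> later_slots t s)" for s and B :: "nat set"
  have fin: "finite Bs" "finite P"
    by (auto simp: Bs_def P_def intro: finite_subset[of _ "Pow {..<n}"])
  have "(\<Sum>B\<in>Bs. card {s \<in> P. Q s B}) = (\<Sum>B\<in>Bs. \<Sum>s\<in>P. if Q s B then 1 else 0)"
    using fin by (simp add: sum.If_cases Int_def)
  also have "\<dots> = (\<Sum>s\<in>P. \<Sum>B\<in>Bs. if Q s B then 1 else 0)" by (rule sum.swap)
  also have "\<dots> = (\<Sum>s\<in>P. card {B \<in> Bs. Q s B})"
    using fin by (simp add: sum.If_cases Int_def)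
  also have "\<dots> = (\<Sum>s\<in>P. gap_choices t j (card (slots s)))"
  proof (rule sum.cong[OF refl])
    fix s assume "s \<in> P"
    then have "length s = n - j"
      by (auto simp: P_def length_finite_permutations_of_set)
    then have "later_slots t s \<subseteq> {..n - j}"
      using slots_subset[of s] by (auto simp: later_slots_def)
    then show "card {B \<in> Bs. Q s B} = gap_choices t j (card (slots s))"
      using card_subsets_by_gaps[of "later_slots t s" "n - j" j] assms
      by (simp add: Bs_def Q_def gap_choices_def card_later_slots conj_assoc)
  qed
  finally show ?thesis by (simp add: Bs_def P_def Q_def conj_assoc)
qed

lemma count_with_Suc:
  "count_with C slots (Suc (Suc t)) (Suc n) =
    (\<Sum>j\<le>n. count_with C slots 0 j *
      (\<Sum>s | s \<in> permutations_of_set {..<n - j} \<and> C s. gap_choices t j (card (slots s))))"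
proof -
  define F where "F B = card {s \<in> permutations_of_set {..<n - card B}. C s \<and> t < card (slots s) \<and>
        (\<forall>r\<in>B. card ({..<r} - B) \<in> later_slots t s)}" for B :: "nat set"
  have "count_with C slots (Suc (Suc t)) (Suc n) =
      (\<Sum>B\<in>Pow {..<n}. F B * count_with C slots 0 (card B))"
    unfolding count_with_def[of _ _ "Suc (Suc t)"] card_permutations_split_max F_def
    by (rule sum.cong[OF refl]) (simp add: card_split_pairs)
  also have "\<dots> = (\<Sum>j\<le>n. \<Sum>B | B \<in> Pow {..<n} \<and> card B = j. F B * count_with C slots 0 (card B))"
    using card_mono[of "{..<n}"]
    by (intro sum.group[symmetric]) auto
  also have "\<dots> = (\<Sum>j\<le>n. count_with C slots 0 j * (\<Sum>B | B \<subseteq> {..<n} \<and> card B = j. F B))"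
    by (auto simp: sum_distrib_left mult.commute intro!: sum.cong)
  also have "\<dots> = (\<Sum>j\<le>n. count_with C slots 0 j *
      (\<Sum>s | s \<in> permutations_of_set {..<n - j} \<and> C s. gap_choices t j (card (slots s))))"
  proof (rule sum.cong[OF refl])
    fix j assume "j \<in> {..n}"
    then have "(\<Sum>B | B \<subseteq> {..<n} \<and> card B = j. F B) =
        (\<Sum>s | s \<in> permutations_of_set {..<n - j} \<and> C s. gap_choices t j (card (slots s)))"
      using sum_over_subsets_gaps[of j n t] by (simp add: F_def)
    then show "count_with C slots 0 j * (\<Sum>B | B \<subseteq> {..<n} \<and> card B = j. F B) =
        count_with C slots 0 j * (\<Sum>s | s \<in> permutations_of_set {..<n - j} \<and> C s.
          gap_choices t j (card (slots s)))" by simp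
  qed
  finally show ?thesis .
qed

end

lemma sum_eq_if_cards_eq:
  fixes f :: "'a \<Rightarrow> nat" and g :: "'b \<Rightarrow> nat" and h :: "nat \<Rightarrow> nat"
  assumes fin: "finite P" "finite Q"
    and eq: "\<And>t. card {x \<in> P. t \<le> f x} = card {y \<in> Q. t \<le> g y}"
  shows "(\<Sum>x\<in>P. h (f x)) = (\<Sum>y\<in>Q. h (g y))"
proof -
  have level: "card {x \<in> A. k x = m} = card {x \<in> A. m \<le> k x} - card {x \<in> A. Suc m \<le> k x}"
    if "finite A" for A :: "'c set" and k :: "'c \<Rightarrow> nat" and m
  proof -
    have "{x \<in> A. k x = m} = {x \<in> A. m \<le> k x} - {x \<in> A. Suc m \<le> k x}" by auto
    then have "card {x \<in> A. k x = m} = card ({x \<in> A. m \<le> k x} - {x \<in> A. Suc m \<le> k x})"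
      by (rule arg_cong)
    also have "\<dots> = card {x \<in> A. m \<le> k x} - card {x \<in> A. Suc m \<le> k x}"
      using that by (intro card_Diff_subset) auto
    finally show ?thesis .
  qed
  have expand: "(\<Sum>x\<in>A. h (k x)) = (\<Sum>m\<in>M. card {x \<in> A. k x = m} * h m)"
    if "finite A" "finite M" "k ` A \<subseteq> M" for A :: "'c set" and k :: "'c \<Rightarrow> nat" and M
  proof -
    have "(\<Sum>x\<in>A. h (k x)) = (\<Sum>m\<in>M. \<Sum>x | x \<in> A \<and> k x = m. h (k x))"
      using sum.group[OF that, of "\<lambda>x. h (k x)"] by simp
    then show ?thesis by simp
  qed
  define M where "M = f ` P \<union> g ` Q"
  have "(\<Sum>x\<in>P. h (f x)) = (\<Sum>m\<in>M. card {x \<in> P. f x = m} * h m)"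
    using fin by (intro expand) (auto simp: M_def)
  also have "\<dots> = (\<Sum>m\<in>M. card {y \<in> Q. g y = m} * h m)"
    using fin eq by (simp add: level)
  also have "\<dots> = (\<Sum>y\<in>Q. h (g y))"
    using fin by (intro expand[symmetric]) (auto simp: M_def)
  finally show ?thesis .
qed

text \<open>In \<open>count_with_Suc\<close> the right-hand side depends on shorter permutations only through the
  distribution of their number of slots. That recursion covers the thresholds from \<open>2\<close> on; nonempty
  members of the class always have two slots, so the thresholds \<open>0\<close> and \<open>1\<close> give the same count
  as \<open>2\<close>.\<close>

lemma count_with_unique:
  assumes "split_at_max le lt C slots" "split_at_max le' lt' C' slots'"
  shows "count_with C slots t k = count_with C' slots' t k"
proof (induction k arbitrary: t rule: less_induct)
  case (less k)
  interpret X: split_at_max le lt C slots by fact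
  interpret Y: split_at_max le' lt' C' slots' by fact
  show ?case
  proof (cases k)
    case 0
    then show ?thesis by (simp add: X.count_with_0 Y.count_with_0)
  next
    case (Suc n)
    have sums: "(\<Sum>s | s \<in> permutations_of_set {..<n - j} \<and> C s. gap_choices t j (card (slots s))) =
        (\<Sum>s | s \<in> permutations_of_set {..<n - j} \<and> C' s. gap_choices t j (card (slots' s)))"
      for t j
      using less.IH[of "n - j"] Suc
      by (intro sum_eq_if_cards_eq) (auto simp: count_with_def conj_assoc)
    have step: "count_with C slots (Suc (Suc t)) (Suc n) = count_with C' slots' (Suc (Suc t)) (Suc n)" for t
      unfolding X.count_with_Suc Y.count_with_Suc
      using less.IH Suc by (intro sum.cong) (auto simp: sums)
    show ?thesis
    proof (cases "t \<le> 1")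
      case True
      then show ?thesis using step[of 0] Suc
        by (simp add: X.count_with_Suc_less Y.count_with_Suc_less numeral_2_eq_2)
    next
      case False
      then have "t = Suc (Suc (t - 2))" by simp
      then show ?thesis using step[of "t - 2"] Suc by metis
    qed
  qed
qed


section \<open>The two classes\<close>

lemma rank_in_le_iff: "finite A \<Longrightarrow> y \<in> A \<Longrightarrow> rank_in A x \<le> rank_in A y \<longleftrightarrow> x \<le> y"
  using rank_in_less_iff[of A y x] by (simp add: not_less[symmetric])

lemma inversions_split_max:
  assumes "\<forall>x\<in>set L \<union> set R. x < z"
  shows "inversions (L @ z # R) = inversions L \<union> inversions R \<union>
    {(x, y). x \<in> set L \<and> y \<in> set R \<and> y < x} \<union> {z} \<times> set R"
proof -
  have "y < z" if "y \<in> set R" for y using assms that by simp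
  moreover have "\<not> z < x" if "x \<in> set L" for x using assms that by (simp add: not_less less_imp_le)
  ultimately show ?thesis by (auto simp: inversions_append)
qed

lemma rank_in_split_max:
  assumes "distinct (L @ z # R)" "\<forall>x\<in>set L \<union> set R. x < z" "x \<le> z"
  shows "rank_in (set (L @ z # R)) x = rank_in (set L) x + rank_in (set R) x"
proof -
  have "rank_in (set (L @ z # R)) x = rank_in (set L \<union> set R) x"
    using assms(3) by (auto simp: rank_in_def intro!: arg_cong[of _ _ card])
  also have "\<dots> = rank_in (set L) x + rank_in (set R) x"
    using assms(1) by (intro rank_in_Un) auto
  finally show ?thesis .
qed

text \<open>Gap \<open>i\<close> separates the \<open>i\<close> smallest values from the others, so it lies above a value of rank less
  than \<open>i\<close> and below a value of rank at least \<open>i\<close>. The uncrossed gaps are the places where the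
  permutation splits as a direct sum.\<close>

definition uncrossed_gaps :: "nat list \<Rightarrow> nat set" where
  "uncrossed_gaps xs = {i. i \<le> length xs \<and> (\<forall>(x, y)\<in>inversions xs.
     \<not> (rank_in (set xs) y < i \<and> i \<le> rank_in (set xs) x))}"

text \<open>Gap \<open>i\<close> belongs to this set iff the entries above it occur in increasing order.\<close>

definition gaps_above_inversions :: "nat list \<Rightarrow> nat set" where
  "gaps_above_inversions xs = {i. i \<le> length xs \<and> (\<forall>(x, y)\<in>inversions xs.
     rank_in (set xs) y < i)}"

lemma ball_inversions_ranks_map:
  assumes "strict_mono_on (set xs) f"
  shows "(\<forall>(x, y)\<in>inversions (map f xs).
        P (rank_in (set (map f xs)) x) (rank_in (set (map f xs)) y)) \<longleftrightarrow>
    (\<forall>(x, y)\<in>inversions xs. P (rank_in (set xs) x) (rank_in (set xs) y))"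
proof -
  have "rank_in (f ` set xs) (f x) = rank_in (set xs) x \<and>
      rank_in (f ` set xs) (f y) = rank_in (set xs) y" if "(x, y) \<in> inversions xs" for x y
    using rank_in_image[OF assms] inversions_in_set[OF that] by simp
  then show ?thesis unfolding inversions_map[OF assms] by fastforce
qed

lemma uncrossed_gaps_map:
  "strict_mono_on (set xs) f \<Longrightarrow> uncrossed_gaps (map f xs) = uncrossed_gaps xs"
  unfolding uncrossed_gaps_def
  using ball_inversions_ranks_map[of xs f "\<lambda>u v. \<not> (v < i \<and> i \<le> u)" for i] by simp

lemma gaps_above_inversions_map:
  "strict_mono_on (set xs) f \<Longrightarrow> gaps_above_inversions (map f xs) = gaps_above_inversions xs"
  unfolding gaps_above_inversions_def
  using ball_inversions_ranks_map[of xs f "\<lambda>u v. v < i" for i] by simp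

lemma length_in_slots:
  "length xs \<in> uncrossed_gaps xs" "length xs \<in> gaps_above_inversions xs"
proof -
  have "rank_in (set xs) x < length xs" if "x \<in> set xs" for x
    using rank_in_less_card[of "set xs" x] that card_length[of xs] by simp
  then show "length xs \<in> uncrossed_gaps xs" "length xs \<in> gaps_above_inversions xs"
    unfolding uncrossed_gaps_def gaps_above_inversions_def
    by (auto simp: not_le dest!: inversions_in_set)
qed

lemma rank_in_uncrossed_iff:
  assumes "distinct xs" "r \<notin> set xs"
  shows "rank_in (set xs) r \<in> uncrossed_gaps xs \<longleftrightarrow> (\<forall>(x, y)\<in>inversions xs. \<not> (y < r \<and> r < x))"
proof -
  have "rank_in (set xs) r \<le> length xs"
    using rank_in_le_card[of "set xs" r] assms by (simp add: distinct_card)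
  moreover have "rank_in (set xs) y < rank_in (set xs) r \<and> rank_in (set xs) r \<le> rank_in (set xs) x
      \<longleftrightarrow> y < r \<and> r < x" if "(x, y) \<in> inversions xs" for x y
  proof -
    have "x \<in> set xs" "y \<in> set xs" using inversions_in_set[OF that] by auto
    moreover from this have "r \<noteq> x" using assms(2) by auto
    ultimately show ?thesis
      using rank_in_less_iff[of "set xs" y r] rank_in_le_iff[of "set xs" x r] by auto
  qed
  ultimately show ?thesis unfolding uncrossed_gaps_def mem_Collect_eq by blast
qed

lemma rank_in_above_iff:
  assumes "distinct xs"
  shows "rank_in (set xs) r \<in> gaps_above_inversions xs \<longleftrightarrow> (\<forall>(x, y)\<in>inversions xs. y < r)"
proof -
  have "rank_in (set xs) r \<le> length xs"
    using rank_in_le_card[of "set xs" r] assms by (simp add: distinct_card)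
  moreover have "rank_in (set xs) y < rank_in (set xs) r \<longleftrightarrow> y < r"
    if "(x, y) \<in> inversions xs" for x y
    using inversions_in_set[OF that] by (simp add: rank_in_less_iff)
  ultimately show ?thesis unfolding gaps_above_inversions_def by auto
qed

text \<open>The maximum \<open>z\<close> forms an inversion with every \<open>r \<in> R\<close>, which blocks all gaps above \<open>r\<close> except the
  topmost one. A gap below all of \<open>R\<close> has only values of \<open>L\<close> beneath it, so it has the same number
  as a gap of \<open>L\<close>, and it is crossed only by inversions of \<open>L\<close>.\<close>

lemma uncrossed_gaps_split:
  assumes "distinct (L @ z # R)" and z: "\<forall>x\<in>set L \<union> set R. x < z"
  shows "uncrossed_gaps (L @ z # R) = insert (length (L @ z # R))
    {i \<in> uncrossed_gaps L. \<forall>r\<in>set R. i \<le> rank_in (set L) r}"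
proof -
  let ?p = "L @ z # R"
  define A where "A = set L"
  define B where "B = set R"
  define W where "W = set ?p"
  have dist: "distinct L" "distinct R" "A \<inter> B = {}" and fin: "finite A" "finite B"
    using assms(1) by (auto simp: A_def B_def)
  have cards: "card A = length L" "card B = length R"
    using dist by (simp_all add: A_def B_def distinct_card)
  have rk: "rank_in W x = rank_in A x + rank_in B x" if "x \<le> z" for x
    using rank_in_split_max[OF assms that] by (simp add: A_def B_def W_def)
  have rkz: "rank_in W z = length L + length R"
  proof -
    have "{y \<in> A. y < z} = A" "{y \<in> B. y < z} = B" using z by (auto simp: A_def B_def)
    then show ?thesis using rk[of z] cards by (simp add: rank_in_def)
  qed
  have inv: "inversions ?p = inversions L \<union> inversions R \<union>
      {(x, y). x \<in> A \<and> y \<in> B \<and> y < x} \<union> {z} \<times> B"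
    using inversions_split_max[OF z] by (simp add: A_def B_def)
  have le: "(\<forall>r\<in>B. i \<le> rank_in W r) \<longleftrightarrow> (\<forall>r\<in>B. i \<le> rank_in A r)" for i
  proof
    assume "\<forall>r\<in>B. i \<le> rank_in A r"
    then show "\<forall>r\<in>B. i \<le> rank_in W r" using rk z by (auto simp: B_def less_imp_le trans_le_add1)
  next
    assume *: "\<forall>r\<in>B. i \<le> rank_in W r"
    show "\<forall>r\<in>B. i \<le> rank_in A r"
    proof
      fix r assume r: "r \<in> B"
      define r0 where "r0 = Min B"
      have r0: "r0 \<in> B" "r0 \<le> r" using r fin by (auto simp: r0_def intro: Min_in)
      have "{y \<in> B. y < r0} = {}"
        using Min_le[OF fin(2)] by (auto simp: r0_def not_less[symmetric])
      then have "rank_in W r0 = rank_in A r0"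
        using rk[of r0] r0 z by (simp add: rank_in_def B_def less_imp_le)
      then show "i \<le> rank_in A r"
        using * r0 rank_in_mono[OF fin(1) r0(2)] by fastforce
    qed
  qed
  have L: "(rank_in W y < i \<and> i \<le> rank_in W x) \<longleftrightarrow> (rank_in A y < i \<and> i \<le> rank_in A x)"
    if i: "\<forall>r\<in>B. i \<le> rank_in A r" and xy: "x \<in> A" "y \<in> A" for i x y
  proof -
    have "i \<le> rank_in W x \<longleftrightarrow> i \<le> rank_in A x" if "x \<in> A" for x
    proof (cases "\<exists>r\<in>B. r < x")
      case True
      then have "i \<le> rank_in A x" using i rank_in_mono[OF fin(1)] by (meson le_trans less_imp_le)
      then show ?thesis using rk[of x] that z by (simp add: A_def less_imp_le)
    next
      case False
      then have "{y \<in> B. y < x} = {}" by auto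
      then have "rank_in B x = 0" unfolding rank_in_def by simp
      then show ?thesis using rk[of x] that z by (simp add: A_def less_imp_le)
    qed
    from this[OF xy(1)] this[OF xy(2)] show ?thesis by (simp add: not_le[symmetric])
  qed
  have main: "i \<in> uncrossed_gaps ?p \<longleftrightarrow> i \<in> uncrossed_gaps L \<and> (\<forall>r\<in>B. i \<le> rank_in A r)"
    if i: "i \<le> length L + length R" for i
  proof
    assume "i \<in> uncrossed_gaps ?p"
    then have *: "\<not> (rank_in W y < i \<and> i \<le> rank_in W x)" if "(x, y) \<in> inversions ?p" for x y
      using that by (auto simp: uncrossed_gaps_def W_def)
    have "i \<le> rank_in W r" if "r \<in> B" for r
      using *[of z r] that i rkz by (simp add: inv)
    then have iA: "\<forall>r\<in>B. i \<le> rank_in A r" using le by blast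
    have "i \<le> length L"
    proof (cases "B = {}")
      case True
      then show ?thesis using i by (simp add: B_def)
    next
      case False
      then obtain r where "r \<in> B" by blast
      then show ?thesis using iA rank_in_le_card[OF fin(1), of r] cards by fastforce
    qed
    moreover have "\<not> (rank_in A y < i \<and> i \<le> rank_in A x)" if "(x, y) \<in> inversions L" for x y
      using *[of x y] L[OF iA, of x y] inversions_in_set[OF that] that by (simp add: inv A_def)
    ultimately show "i \<in> uncrossed_gaps L \<and> (\<forall>r\<in>B. i \<le> rank_in A r)"
      using iA by (auto simp: uncrossed_gaps_def A_def)
  next
    assume R: "i \<in> uncrossed_gaps L \<and> (\<forall>r\<in>B. i \<le> rank_in A r)"
    then have iA: "\<forall>r\<in>B. i \<le> rank_in A r" and iW: "\<forall>r\<in>B. i \<le> rank_in W r" using le by auto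
    have "\<not> (rank_in W y < i \<and> i \<le> rank_in W x)" if xy: "(x, y) \<in> inversions ?p" for x y
    proof (cases "y \<in> B")
      case True
      then show ?thesis using iW by auto
    next
      case False
      then have xyL: "(x, y) \<in> inversions L"
        using xy inversions_in_set[of x y R] by (auto simp: inv B_def)
      then show ?thesis
        using L[OF iA, of x y] inversions_in_set[OF xyL] R by (auto simp: uncrossed_gaps_def A_def)
    qed
    then show "i \<in> uncrossed_gaps ?p"
      using i by (auto simp: uncrossed_gaps_def W_def)
  qed
  have small: "uncrossed_gaps L \<subseteq> {..length L}" by (auto simp: uncrossed_gaps_def)
  show ?thesis
  proof (rule set_eqI)
    fix i
    consider "i \<le> length L + length R" | "i = length ?p" | "i > length ?p" by fastforce
    then show "i \<in> uncrossed_gaps ?p \<longleftrightarrow> i \<in> insert (length ?p)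
        {i \<in> uncrossed_gaps L. \<forall>r\<in>set R. i \<le> rank_in (set L) r}"
    proof cases
      case 1
      then show ?thesis using main[OF 1] by (auto simp: A_def B_def)
    next
      case 2
      then show ?thesis using length_in_slots(1)[of ?p] by simp
    next
      case 3
      then have "i \<notin> uncrossed_gaps ?p" by (simp add: uncrossed_gaps_def)
      then show ?thesis using 3 small by auto
    qed
  qed
qed

text \<open>The inversions formed by the maximum \<open>z\<close> block all gaps that do not lie above \<open>R\<close>, and other
  inversions whose lower entry is in \<open>R\<close> then block nothing more. The
  remaining gaps correspond to gaps of \<open>L\<close>, shifted by the number of elements of \<open>R\<close>, all of which
  lie beneath them.\<close>

lemma gaps_above_inversions_split:
  assumes "distinct (L @ z # R)" and z: "\<forall>x\<in>set L \<union> set R. x < z"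
  shows "gaps_above_inversions (L @ z # R) = insert (length (L @ z # R))
    ((+) (length R) ` {i \<in> gaps_above_inversions L. \<forall>r\<in>set R. rank_in (set L) r \<le> i})"
proof -
  let ?p = "L @ z # R"
  define A where "A = set L"
  define B where "B = set R"
  define W where "W = set ?p"
  have dist: "distinct L" "distinct R" "A \<inter> B = {}" and fin: "finite A" "finite B"
    using assms(1) by (auto simp: A_def B_def)
  have cards: "card A = length L" "card B = length R"
    using dist by (simp_all add: A_def B_def distinct_card)
  have rk: "rank_in W x = rank_in A x + rank_in B x" if "x \<in> A \<union> B" for x
  proof -
    have "x \<le> z" using that z by (auto simp: A_def B_def less_imp_le)
    then show ?thesis using rank_in_split_max[OF assms] by (simp add: A_def B_def W_def)
  qed
  have inv: "inversions ?p = inversions L \<union> inversions R \<union>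
      {(x, y). x \<in> A \<and> y \<in> B \<and> y < x} \<union> {z} \<times> B"
    using inversions_split_max[OF z] by (simp add: A_def B_def)
  have up: "length R + i \<in> gaps_above_inversions ?p"
    if "i \<in> gaps_above_inversions L" "\<forall>r\<in>B. rank_in A r \<le> i" for i
  proof -
    have "rank_in W y < length R + i" if xy: "(x, y) \<in> inversions ?p" for x y
    proof (cases "y \<in> B")
      case True
      then show ?thesis
        using rk[of y] rank_in_less_card[OF fin(2) True] cards \<open>\<forall>r\<in>B. _\<close> by fastforce
    next
      case False
      then have xyL: "(x, y) \<in> inversions L"
        using xy inversions_in_set[of x y R] by (auto simp: inv B_def)
      then have "rank_in A y < i"
        using \<open>i \<in> gaps_above_inversions L\<close> by (auto simp: gaps_above_inversions_def A_def)
      moreover have "y \<in> A" using inversions_in_set[OF xyL] by (simp add: A_def)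
      ultimately show ?thesis
        using rk[of y] rank_in_le_card[OF fin(2), of y] cards by simp
    qed
    then show ?thesis using that(1) by (auto simp: gaps_above_inversions_def W_def)
  qed
  \<comment> \<open>A surviving gap lies above the maximum of \<open>R\<close>; an inversion of \<open>L\<close> whose lower entry is below that
    maximum then blocks nothing, and for a lower entry above it the shift by \<open>length R\<close> is exact.\<close>
  have down: "\<exists>i'. i = length R + i' \<and> i' \<in> gaps_above_inversions L \<and> (\<forall>r\<in>B. rank_in A r \<le> i')"
    if i: "i \<le> length L + length R" and mem: "i \<in> gaps_above_inversions ?p" for i
  proof -
    have *: "rank_in W y < i" if "(x, y) \<in> inversions ?p" for x y
      using mem that by (auto simp: gaps_above_inversions_def W_def)
    have L: "rank_in W y < i" if "(x, y) \<in> inversions L" for x y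
      using *[of x y] that by (simp add: inv)
    show ?thesis
    proof (cases "B = {}")
      case True
      then have "rank_in W x = rank_in A x" if "x \<in> A" for x
        using rk[of x] that by (simp add: rank_in_def)
      then have "i \<in> gaps_above_inversions L"
        using L i True inversions_in_set[of _ _ L]
        by (fastforce simp: gaps_above_inversions_def A_def B_def)
      then show ?thesis using True by (auto simp: B_def)
    next
      case False
      define m where "m = Max B"
      have m: "m \<in> B" "\<And>r. r \<in> B \<Longrightarrow> r \<le> m" using fin False by (auto simp: m_def)
      have "{y \<in> B. y < m} = B - {m}" using m by (auto simp: order_le_less)
      then have "Suc (rank_in B m) = length R"
        using card_Suc_Diff1[OF fin(2) m(1)] cards by (simp add: rank_in_def)
      moreover have "rank_in W m < i" using *[of z m] m(1) by (simp add: inv)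
      ultimately have im: "length R + rank_in A m \<le> i" using rk[of m] m(1) by simp
      define i' where "i' = i - length R"
      have i': "i = length R + i'" "rank_in A m \<le> i'" using im by (auto simp: i'_def)
      have "rank_in A y < i'" if xy: "(x, y) \<in> inversions L" for x y
      proof (cases "y < m")
        case True
        then show ?thesis using i' inversions_in_set[OF xy] rank_in_less_iff[OF fin(1), of y m]
          by (simp add: A_def)
      next
        case False
        have y: "y \<in> A" using inversions_in_set[OF xy] by (simp add: A_def)
        then have "m < y" using False m(1) dist by (metis IntI empty_iff linorder_neqE_nat)
        then have "{w \<in> B. w < y} = B" using m(2) by (auto intro: le_less_trans)
        then have "rank_in B y = length R" using cards by (simp add: rank_in_def)
        then show ?thesis using L[OF xy] rk[of y] y i' by simp
      qed
      then have "i' \<in> gaps_above_inversions L"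
        using i i' by (auto simp: gaps_above_inversions_def A_def)
      moreover have "rank_in A r \<le> i'" if "r \<in> B" for r
        using rank_in_mono[OF fin(1) m(2)[OF that]] i' by simp
      ultimately show ?thesis using i' by blast
    qed
  qed
  show ?thesis
  proof (rule set_eqI)
    fix i
    have iff: "i \<in> (+) (length R) ` {i \<in> gaps_above_inversions L. \<forall>r\<in>set R. rank_in (set L) r \<le> i}
        \<longleftrightarrow> (\<exists>i'. i = length R + i' \<and> i' \<in> gaps_above_inversions L \<and> (\<forall>r\<in>B. rank_in A r \<le> i'))"
      by (auto simp: A_def B_def)
    consider "i \<le> length L + length R" | "i = length ?p" | "i > length ?p" by fastforce
    then show "i \<in> gaps_above_inversions ?p \<longleftrightarrow> i \<in> insert (length ?p)
        ((+) (length R) ` {i \<in> gaps_above_inversions L. \<forall>r\<in>set R. rank_in (set L) r \<le> i})"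
    proof cases
      case 1
      then show ?thesis unfolding insert_iff iff using up down[OF 1] by auto
    next
      case 2
      then show ?thesis using length_in_slots(2)[of ?p] by simp
    next
      case 3
      then show ?thesis unfolding insert_iff iff by (auto simp: gaps_above_inversions_def)
    qed
  qed
qed


section \<open>The two patterns\<close>

lemma nth_less_if_reduced_form_less:
  assumes "i < length xs" "j < length xs" "reduced_form xs ! i < reduced_form xs ! j"
  shows "xs ! i < xs ! j"
proof (rule ccontr)
  assume "\<not> xs ! i < xs ! j"
  then have "card {w \<in> set xs. w \<le> xs ! j} \<le> card {w \<in> set xs. w \<le> xs ! i}"
    by (intro card_mono) auto
  then show False using assms by (simp add: reduced_form_def)
qed

lemma reduced_form_distinct:
  assumes "distinct xs"
  shows "reduced_form xs = map (\<lambda>x. length (filter (\<lambda>y. y \<le> x) xs)) xs"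
proof -
  have "{y \<in> set xs. y \<le> x} = {y. y \<le> x} \<inter> set xs" for x by auto
  then show ?thesis using assms by (simp add: reduced_form_def distinct_length_filter)
qed

lemma reduced_form_eq_iff:
  "reduced_form [a, b, c, d] = [3, 1, 4, 2] \<longleftrightarrow> b < d \<and> d < a \<and> a < c"
  "reduced_form [a, b, c, d] = [3, 2, 4, 1] \<longleftrightarrow> d < b \<and> b < a \<and> a < c"
  "reduced_form [a, e, b, c, d] = [3, 5, 2, 4, 1] \<longleftrightarrow> d < b \<and> b < a \<and> a < c \<and> c < e"
proof -
  show "reduced_form [a, b, c, d] = [3, 1, 4, 2] \<longleftrightarrow> b < d \<and> d < a \<and> a < c"
  proof
    assume *: "reduced_form [a, b, c, d] = [3, 1, 4, 2]"
    have "[a, b, c, d] ! 1 < [a, b, c, d] ! 3" "[a, b, c, d] ! 3 < [a, b, c, d] ! 0"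
      "[a, b, c, d] ! 0 < [a, b, c, d] ! 2"
      by (rule nth_less_if_reduced_form_less; simp add: *)+
    then show "b < d \<and> d < a \<and> a < c" by simp
  next
    assume "b < d \<and> d < a \<and> a < c"
    then show "reduced_form [a, b, c, d] = [3, 1, 4, 2]"
      by (subst reduced_form_distinct) auto
  qed
  show "reduced_form [a, b, c, d] = [3, 2, 4, 1] \<longleftrightarrow> d < b \<and> b < a \<and> a < c"
  proof
    assume *: "reduced_form [a, b, c, d] = [3, 2, 4, 1]"
    have "[a, b, c, d] ! 3 < [a, b, c, d] ! 1" "[a, b, c, d] ! 1 < [a, b, c, d] ! 0"
      "[a, b, c, d] ! 0 < [a, b, c, d] ! 2"
      by (rule nth_less_if_reduced_form_less; simp add: *)+
    then show "d < b \<and> b < a \<and> a < c" by simp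
  next
    assume "d < b \<and> b < a \<and> a < c"
    then show "reduced_form [a, b, c, d] = [3, 2, 4, 1]"
      by (subst reduced_form_distinct) auto
  qed
  show "reduced_form [a, e, b, c, d] = [3, 5, 2, 4, 1] \<longleftrightarrow> d < b \<and> b < a \<and> a < c \<and> c < e"
  proof
    assume *: "reduced_form [a, e, b, c, d] = [3, 5, 2, 4, 1]"
    have "[a, e, b, c, d] ! 4 < [a, e, b, c, d] ! 2" "[a, e, b, c, d] ! 2 < [a, e, b, c, d] ! 0"
      "[a, e, b, c, d] ! 0 < [a, e, b, c, d] ! 3" "[a, e, b, c, d] ! 3 < [a, e, b, c, d] ! 1"
      by (rule nth_less_if_reduced_form_less; simp add: *)+
    then show "d < b \<and> b < a \<and> a < c \<and> c < e" by simp
  next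
    assume "d < b \<and> b < a \<and> a < c \<and> c < e"
    then show "reduced_form [a, e, b, c, d] = [3, 5, 2, 4, 1]"
      by (subst reduced_form_distinct) auto
  qed
qed

lemma avoiding_31_4_2_iff:
  "avoiding_31_4_2 p \<longleftrightarrow> (\<forall>i j k. i + 1 < j \<and> j < k \<and> k < length p \<longrightarrow>
     \<not> (p ! (i + 1) < p ! k \<and> p ! k < p ! i \<and> p ! i < p ! j))"
  unfolding avoiding_31_4_2_def instance_31_4_2_def reduced_form_eq_iff by blast

lemma satisfying_3_5_2_4_1_iff:
  "satisfying_3_5_2_4_1 p \<longleftrightarrow> (\<forall>a b c d. a < b \<and> b < c \<and> c < d \<and> d < length p \<and>
     p ! d < p ! b \<and> p ! b < p ! a \<and> p ! a < p ! c \<longrightarrow> (\<exists>e. a < e \<and> e < b \<and> p ! c < p ! e))"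
  unfolding satisfying_3_5_2_4_1_def instance_3_2_4_1_def reduced_form_eq_iff by blast

lemma map_nth_less_iff:
  fixes f :: "nat \<Rightarrow> nat"
  shows "strict_mono_on (set xs) f \<Longrightarrow> i < length xs \<Longrightarrow> j < length xs \<Longrightarrow>
     map f xs ! i < map f xs ! j \<longleftrightarrow> xs ! i < xs ! j"
  using strict_mono_on_less[of "set xs" f "xs ! i" "xs ! j"] by simp

lemma avoiding_map:
  assumes "strict_mono_on (set xs) f"
  shows "avoiding_31_4_2 (map f xs) \<longleftrightarrow> avoiding_31_4_2 xs"
  unfolding avoiding_31_4_2_iff length_map
  by (intro all_cong1 imp_cong refl) (simp add: map_nth_less_iff[OF assms] del: nth_map)

lemma satisfying_map:
  assumes "strict_mono_on (set xs) f"
  shows "satisfying_3_5_2_4_1 (map f xs) \<longleftrightarrow> satisfying_3_5_2_4_1 xs"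
proof -
  have bars: "(\<exists>e. a < e \<and> e < b \<and> map f xs ! c < map f xs ! e) \<longleftrightarrow>
      (\<exists>e. a < e \<and> e < b \<and> xs ! c < xs ! e)"
    if "b < c" "c < length xs" for a b c
  proof -
    have "map f xs ! c < map f xs ! e \<longleftrightarrow> xs ! c < xs ! e" if "e < b" for e
      using map_nth_less_iff[OF assms, of c e] that \<open>b < c\<close> \<open>c < length xs\<close> by linarith
    then show ?thesis by blast
  qed
  have "(a < b \<and> b < c \<and> c < d \<and> d < length xs \<and>
      map f xs ! d < map f xs ! b \<and> map f xs ! b < map f xs ! a \<and> map f xs ! a < map f xs ! c \<longrightarrow>
        (\<exists>e. a < e \<and> e < b \<and> map f xs ! c < map f xs ! e)) \<longleftrightarrow>
      (a < b \<and> b < c \<and> c < d \<and> d < length xs \<and>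
      xs ! d < xs ! b \<and> xs ! b < xs ! a \<and> xs ! a < xs ! c \<longrightarrow>
        (\<exists>e. a < e \<and> e < b \<and> xs ! c < xs ! e))" for a b c d
  proof (cases "a < b \<and> b < c \<and> c < d \<and> d < length xs")
    case True
    then show ?thesis
      by (simp add: map_nth_less_iff[OF assms] bars del: nth_map)
  next
    case False
    then show ?thesis by argo
  qed
  then show ?thesis unfolding satisfying_3_5_2_4_1_iff length_map by (intro all_cong1)
qed

text \<open>A discrete intermediate value argument: going from a value above \<open>r\<close> to a value below it, some
  consecutive pair of entries steps across \<open>r\<close>.\<close>

lemma ex_descent_across:
  assumes "p < q" "q < length xs" "xs ! q < (r :: nat)" "r < xs ! p" "r \<notin> set xs"
  shows "\<exists>i. i + 1 < length xs \<and> xs ! (i + 1) < r \<and> r < xs ! i"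
  using assms(1,2,3)
proof (induction q)
  case (Suc q)
  show ?case
  proof (cases "r < xs ! q")
    case True
    then show ?thesis using Suc.prems by (intro exI[of _ q]) simp
  next
    case False
    moreover have "xs ! q \<noteq> r" using assms(5) Suc.prems(2) by (metis Suc_lessD nth_mem)
    ultimately have "xs ! q < r" by simp
    moreover from this have "p < q" using assms(4) Suc.prems(1) by (metis less_antisym less_asym)
    ultimately show ?thesis using Suc.IH Suc.prems by simp
  qed
qed simp

lemma descent_across_iff_inversion:
  assumes "r \<notin> set xs"
  shows "(\<exists>i. i + 1 < length xs \<and> xs ! (i + 1) < r \<and> r < xs ! i) \<longleftrightarrow>
    (\<exists>(x, y)\<in>inversions xs. y < r \<and> r < x)"
proof
  assume "\<exists>i. i + 1 < length xs \<and> xs ! (i + 1) < r \<and> r < xs ! i"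
  then obtain i where i: "i + 1 < length xs" "xs ! (i + 1) < r" "r < xs ! i" by blast
  then have "(xs ! i, xs ! (i + 1)) \<in> inversions xs"
    unfolding inversions_nth by (intro exI[of _ i] exI[of _ "i + 1"]) simp
  then show "\<exists>(x, y)\<in>inversions xs. y < r \<and> r < x" using i by blast
next
  assume "\<exists>(x, y)\<in>inversions xs. y < r \<and> r < x"
  then obtain x y where xy: "(x, y) \<in> inversions xs" "y < r" "r < x" by blast
  then obtain p q where "p < q" "q < length xs" "xs ! p = x" "xs ! q = y"
    by (auto simp: inversions_nth)
  then show "\<exists>i. i + 1 < length xs \<and> xs ! (i + 1) < r \<and> r < xs ! i"
    using xy assms by (intro ex_descent_across) auto
qed

lemma nth_split_max:
  "i < length L \<Longrightarrow> (L @ z # R) ! i = L ! i"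
  "(L @ z # R) ! length L = z"
  "(L @ z # R) ! (Suc (length L) + i) = R ! i"
  by (simp_all add: nth_append)

lemma position_cases:
  fixes i :: nat
  assumes "i < length (L @ z # R)"
  obtains "i < length L" | "i = length L" | i' where "i = Suc (length L) + i'" "i' < length R"
proof -
  consider "i < length L" | "i = length L" | "i > length L" by linarith
  then show thesis
  proof cases
    case 1
    then show thesis by (rule that(1))
  next
    case 2
    then show thesis by (rule that(2))
  next
    case 3
    then have "i = Suc (length L) + (i - Suc (length L))" "i - Suc (length L) < length R"
      using assms by auto
    then show thesis by (rule that(3))
  qed
qed

text \<open>An entry that is smaller than some other entry is not \<open>z\<close>, so in an instance \<open>z\<close> could only be the
  \<open>4\<close>. In particular, the adjacent letters \<open>31\<close> lie both in \<open>L\<close> or both in \<open>R\<close>; if they lie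
  in \<open>L\<close> and the \<open>2\<close> lies in \<open>R\<close>, the letters \<open>31\<close> are a descent across an element of \<open>R\<close>, and \<open>z\<close>
  completes any such descent to an instance.\<close>

lemma avoiding_split:
  assumes "distinct (L @ z # R)" and z: "\<forall>x\<in>set L \<union> set R. x < z"
  shows "avoiding_31_4_2 (L @ z # R) \<longleftrightarrow> avoiding_31_4_2 L \<and> avoiding_31_4_2 R \<and>
    (\<forall>r\<in>set R. rank_in (set L) r \<in> uncrossed_gaps L)"
proof -
  let ?p = "L @ z # R"
  let ?k = "length L"
  have dL: "distinct L" and disj: "\<And>r. r \<in> set R \<Longrightarrow> r \<notin> set L" using assms(1) by auto
  have compat: "(\<forall>r\<in>set R. rank_in (set L) r \<in> uncrossed_gaps L) \<longleftrightarrow>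
      (\<forall>r\<in>set R. \<not> (\<exists>i. i + 1 < ?k \<and> L ! (i + 1) < r \<and> r < L ! i))"
    using rank_in_uncrossed_iff[OF dL disj] descent_across_iff_inversion[OF disj] by blast
  have le_z: "?p ! i \<le> z" if "i < length ?p" for i
    using nth_mem[OF that] z by (auto simp: less_imp_le)
  show ?thesis unfolding compat
  proof (intro iffI conjI)
    assume *: "avoiding_31_4_2 ?p"
    show "avoiding_31_4_2 L"
      unfolding avoiding_31_4_2_iff
    proof (intro allI impI)
      fix i j k assume "i + 1 < j \<and> j < k \<and> k < length L"
      then show "\<not> (L ! (i + 1) < L ! k \<and> L ! k < L ! i \<and> L ! i < L ! j)"
        using *[unfolded avoiding_31_4_2_iff, rule_format, of i j k]
        by (simp add: nth_split_max)
    qed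
    show "avoiding_31_4_2 R"
      unfolding avoiding_31_4_2_iff
    proof (intro allI impI)
      fix i j k assume "i + 1 < j \<and> j < k \<and> k < length R"
      then show "\<not> (R ! (i + 1) < R ! k \<and> R ! k < R ! i \<and> R ! i < R ! j)"
        using *[unfolded avoiding_31_4_2_iff, rule_format,
            of "Suc ?k + i" "Suc ?k + j" "Suc ?k + k"]
          nth_split_max(3)[of L z R "i + 1"]
        by (simp add: nth_split_max(3)[of L z R, simplified])
    qed
    show "\<forall>r\<in>set R. \<not> (\<exists>i. i + 1 < ?k \<and> L ! (i + 1) < r \<and> r < L ! i)"
    proof (intro ballI notI)
      fix r assume r: "r \<in> set R" and "\<exists>i. i + 1 < ?k \<and> L ! (i + 1) < r \<and> r < L ! i"
      then obtain i where i: "i + 1 < ?k" "L ! (i + 1) < r" "r < L ! i" by blast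
      obtain m where m: "m < length R" "R ! m = r" using r by (auto simp: in_set_conv_nth)
      have "L ! i < z" using z i by simp
      then show False
        using *[unfolded avoiding_31_4_2_iff, rule_format, of i ?k "Suc ?k + m"] i m
          nth_split_max(3)[of L z R m] by (simp add: nth_split_max(1,2))
    qed
  next
    assume R: "avoiding_31_4_2 L \<and> avoiding_31_4_2 R \<and>
      (\<forall>r\<in>set R. \<not> (\<exists>i. i + 1 < ?k \<and> L ! (i + 1) < r \<and> r < L ! i))"
    show "avoiding_31_4_2 ?p"
      unfolding avoiding_31_4_2_iff
    proof (intro allI impI notI)
      fix i j k
      assume pos: "i + 1 < j \<and> j < k \<and> k < length ?p"
        and vals: "?p ! (i + 1) < ?p ! k \<and> ?p ! k < ?p ! i \<and> ?p ! i < ?p ! j"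
      have "?p ! i < z" "?p ! (i + 1) < z" "?p ! k < z"
        using vals le_z[of i] le_z[of j] pos by auto
      then have ne: "i \<noteq> ?k" "i + 1 \<noteq> ?k" "k \<noteq> ?k"
        using nth_split_max(2)[of L z R] by (metis less_irrefl)+
      from pos have ik: "i < length ?p" "k < length ?p" by auto
      show False
      proof (cases rule: position_cases[OF ik(1)])
        case 1
        then have i: "i + 1 < ?k" using ne by simp
        show False
        proof (cases rule: position_cases[OF ik(2)])
          case 1
          then show False using R pos vals i
            unfolding avoiding_31_4_2_iff by (auto simp: nth_split_max)
        next
          case 2
          then show False using ne by simp
        next
          case (3 k')
          then have "L ! (i + 1) < R ! k'" "R ! k' < L ! i"
            using vals i nth_split_max(3)[of L z R k'] by (simp_all add: nth_split_max(1))
          then show False using R i 3(2) nth_mem[OF 3(2)] by blast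
        qed
      next
        case 2
        then show False using ne by simp
      next
        case (3 i')
        then obtain j' k' where jk: "j = Suc ?k + j'" "k = Suc ?k + k'"
          using pos by (metis add.assoc less_imp_add_positive trans_less_add1)
        then show False
          using R[THEN conjunct2, THEN conjunct1, unfolded avoiding_31_4_2_iff, rule_format, of i' j' k']
            pos vals 3 nth_split_max(3)[of L z R i'] nth_split_max(3)[of L z R "i' + 1"]
            nth_split_max(3)[of L z R j'] nth_split_max(3)[of L z R k']
          by simp
      qed
    qed
  qed
qed

text \<open>Consider an instance \<open>a b c d\<close> of 3-2-4-1. If it lies within \<open>L\<close> or within \<open>R\<close>, then so does any
  letter \<open>5\<close> for it. If \<open>b\<close> is in \<open>L\<close> and \<open>d\<close> in \<open>R\<close>, then \<open>a b\<close> is an inversion of \<open>L\<close> above an element of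
  \<open>R\<close>; such an inversion is excluded because with \<open>z\<close> as the \<open>4\<close> there is no larger value for
  the \<open>5\<close>. If \<open>a\<close> is in \<open>L\<close> and \<open>b\<close> in \<open>R\<close>, then \<open>z\<close> is the required \<open>5\<close>.\<close>

lemma satisfying_split:
  assumes "distinct (L @ z # R)" and z: "\<forall>x\<in>set L \<union> set R. x < z"
  shows "satisfying_3_5_2_4_1 (L @ z # R) \<longleftrightarrow> satisfying_3_5_2_4_1 L \<and> satisfying_3_5_2_4_1 R \<and>
    (\<forall>r\<in>set R. rank_in (set L) r \<in> gaps_above_inversions L)"
proof -
  let ?p = "L @ z # R"
  let ?k = "length L"
  have dL: "distinct L" and disj: "\<And>r. r \<in> set R \<Longrightarrow> r \<notin> set L" using assms(1) by auto
  have compat: "(\<forall>r\<in>set R. rank_in (set L) r \<in> gaps_above_inversions L) \<longleftrightarrow>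
      (\<forall>r\<in>set R. \<forall>(x, y)\<in>inversions L. y < r)"
    using rank_in_above_iff[OF dL] by blast
  have le_z: "?p ! i \<le> z" if "i < length ?p" for i
    using nth_mem[OF that] z by (auto simp: less_imp_le)
  show ?thesis unfolding compat
  proof (intro iffI conjI)
    assume *: "satisfying_3_5_2_4_1 ?p"
    show "satisfying_3_5_2_4_1 L"
      unfolding satisfying_3_5_2_4_1_iff
    proof (intro allI impI)
      fix a b c d
      assume h: "a < b \<and> b < c \<and> c < d \<and> d < ?k \<and> L ! d < L ! b \<and> L ! b < L ! a \<and> L ! a < L ! c"
      then obtain e where "a < e" "e < b" "?p ! c < ?p ! e"
        using *[unfolded satisfying_3_5_2_4_1_iff, rule_format, of a b c d]
        by (auto simp: nth_split_max)
      then show "\<exists>e. a < e \<and> e < b \<and> L ! c < L ! e"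
        using h by (intro exI[of _ e]) (simp add: nth_split_max)
    qed
    show "satisfying_3_5_2_4_1 R"
      unfolding satisfying_3_5_2_4_1_iff
    proof (intro allI impI)
      fix a b c d
      assume h: "a < b \<and> b < c \<and> c < d \<and> d < length R \<and> R ! d < R ! b \<and> R ! b < R ! a \<and> R ! a < R ! c"
      then obtain e where e: "Suc ?k + a < e" "e < Suc ?k + b" "?p ! (Suc ?k + c) < ?p ! e"
        using *[unfolded satisfying_3_5_2_4_1_iff, rule_format,
            of "Suc ?k + a" "Suc ?k + b" "Suc ?k + c" "Suc ?k + d"]
        unfolding nth_split_max(3) by auto
      then obtain e' where e': "e = Suc ?k + e'"
        by (metis add.assoc less_imp_add_positive)
      then show "\<exists>e. a < e \<and> e < b \<and> R ! c < R ! e"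
        using e unfolding e' nth_split_max(3) by (intro exI[of _ e']) simp
    qed
    show "\<forall>r\<in>set R. \<forall>(x, y)\<in>inversions L. y < r"
    proof (intro ballI, safe, rule ccontr)
      fix r x y assume r: "r \<in> set R" and xy: "(x, y) \<in> inversions L" and "\<not> y < r"
      moreover have "y \<noteq> r" using disj[OF r] inversions_in_set[OF xy] by auto
      ultimately have "r < y" by simp
      obtain a b where ab: "a < b" "b < ?k" "L ! a = x" "L ! b = y" "y < x"
        using xy by (auto simp: inversions_nth)
      obtain m where m: "m < length R" "R ! m = r" using r by (auto simp: in_set_conv_nth)
      have "x < z" using z inversions_in_set[OF xy] by simp
      have "?p ! a = x" "?p ! b = y" "?p ! ?k = z" "?p ! (Suc ?k + m) = r"
        using ab m by (simp_all only: nth_split_max)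
      then obtain e where "a < e" "e < b" "z < ?p ! e"
        using *[unfolded satisfying_3_5_2_4_1_iff, rule_format, of a b ?k "Suc ?k + m"]
          ab m \<open>r < y\<close> \<open>x < z\<close> by auto
      then show False using le_z[of e] ab by simp
    qed
  next
    assume R: "satisfying_3_5_2_4_1 L \<and> satisfying_3_5_2_4_1 R \<and>
      (\<forall>r\<in>set R. \<forall>(x, y)\<in>inversions L. y < r)"
    show "satisfying_3_5_2_4_1 ?p"
      unfolding satisfying_3_5_2_4_1_iff
    proof (intro allI impI)
      fix a b c d
      assume h: "a < b \<and> b < c \<and> c < d \<and> d < length ?p \<and>
        ?p ! d < ?p ! b \<and> ?p ! b < ?p ! a \<and> ?p ! a < ?p ! c"
      have "?p ! a < z" "?p ! b < z" "?p ! d < z" using h le_z[of a] le_z[of c] by auto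
      then have ne: "a \<noteq> ?k" "b \<noteq> ?k" "d \<noteq> ?k"
        using nth_split_max(2)[of L z R] by (metis less_irrefl)+
      consider "d < ?k" | "b < ?k" "?k < d" | "a < ?k" "?k < b" | "?k < a"
        using ne h by linarith
      then show "\<exists>e. a < e \<and> e < b \<and> ?p ! c < ?p ! e"
      proof cases
        case 1
        then obtain e where "a < e" "e < b" "L ! c < L ! e"
          using R[THEN conjunct1, unfolded satisfying_3_5_2_4_1_iff, rule_format, of a b c d] h
          by (auto simp: nth_split_max)
        then show ?thesis using 1 h by (intro exI[of _ e]) (simp add: nth_split_max)
      next
        case 2
        then obtain d' where d': "d = Suc ?k + d'" by (metis less_iff_Suc_add add_Suc)
        then have "d' < length R" using h by simp
        moreover have "(L ! a, L ! b) \<in> inversions L"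
        proof -
          have "a < ?k" using h 2 by linarith
          then have "?p ! a = L ! a" "?p ! b = L ! b" using 2 by (simp_all only: nth_split_max(1))
          then have "L ! b < L ! a" using h by metis
          then show ?thesis unfolding inversions_nth using h 2 by blast
        qed
        ultimately have "L ! b < R ! d'" using R by fastforce
        moreover have "?p ! d = R ! d'" unfolding d' by (rule nth_split_max)
        ultimately show ?thesis using h 2 by (simp add: nth_split_max(1))
      next
        case 3
        have "?p ! c \<noteq> z"
          using assms(1) h 3 nth_eq_iff_index_eq[of ?p c ?k] nth_split_max(2)[of L z R] by simp
        then have "?p ! c < z" using le_z[of c] h by simp
        then show ?thesis using 3 by (intro exI[of _ ?k]) (simp add: nth_split_max(2))
      next
        case 4
        then obtain a' b' c' d' where p: "a = Suc ?k + a'" "b = Suc ?k + b'" "c = Suc ?k + c'"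
            "d = Suc ?k + d'"
          using h less_trans by (metis less_iff_Suc_add add_Suc)
        obtain e where "a' < e" "e < b'" "R ! c' < R ! e"
          using R[THEN conjunct2, THEN conjunct1, unfolded satisfying_3_5_2_4_1_iff, rule_format,
              of a' b' c' d'] h
          unfolding p nth_split_max(3) by auto
        then show ?thesis unfolding p
          by (intro exI[of _ "Suc ?k + e"]) (simp only: nth_split_max(3), simp)
      qed
    qed
  qed
qed

lemma split_at_max_avoiding:
  "split_at_max (\<le>) (<) avoiding_31_4_2 uncrossed_gaps"
proof (rule split_at_max.intro)
  show "class.linorder (\<le>) ((<) :: nat \<Rightarrow> nat \<Rightarrow> bool)" by unfold_locales
  show "avoiding_31_4_2 []" by (simp add: avoiding_31_4_2_iff)
  show "uncrossed_gaps xs \<subseteq> {..length xs}" for xs by (auto simp: uncrossed_gaps_def)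
  show "uncrossed_gaps xs \<noteq> {}" for xs using length_in_slots(1) by blast
  fix L R :: "nat list" and z assume *: "distinct (L @ z # R)" "\<forall>x\<in>set L \<union> set R. x < z"
  have "uncrossed_gaps L \<subseteq> {..length L}" by (auto simp: uncrossed_gaps_def)
  then show "card (uncrossed_gaps (L @ z # R)) =
      Suc (card {i \<in> uncrossed_gaps L. \<forall>r\<in>set R. i \<le> rank_in (set L) r})"
    unfolding uncrossed_gaps_split[OF *]
    by (subst card_insert_disjoint) (auto intro: finite_subset[of _ "{..length L}"])
qed (fact avoiding_map uncrossed_gaps_map avoiding_split)+

lemma split_at_max_satisfying:
  "split_at_max (\<ge>) (>) satisfying_3_5_2_4_1 gaps_above_inversions"
proof (rule split_at_max.intro)
  show "class.linorder (\<ge>) ((>) :: nat \<Rightarrow> nat \<Rightarrow> bool)" by (rule dual_linorder)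
  show "satisfying_3_5_2_4_1 []" by (simp add: satisfying_3_5_2_4_1_iff)
  show "gaps_above_inversions xs \<subseteq> {..length xs}" for xs by (auto simp: gaps_above_inversions_def)
  show "gaps_above_inversions xs \<noteq> {}" for xs using length_in_slots(2) by blast
  fix L R :: "nat list" and z assume *: "distinct (L @ z # R)" "\<forall>x\<in>set L \<union> set R. x < z"
  let ?G = "{i \<in> gaps_above_inversions L. \<forall>r\<in>set R. rank_in (set L) r \<le> i}"
  have sub: "?G \<subseteq> {..length L}" by (auto simp: gaps_above_inversions_def)
  then have "finite ?G" by (rule finite_subset) simp
  moreover have "length (L @ z # R) \<notin> (+) (length R) ` ?G" using sub by auto
  ultimately show "card (gaps_above_inversions (L @ z # R)) = Suc (card ?G)"
    unfolding gaps_above_inversions_split[OF *] by (simp add: card_image)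
qed (fact satisfying_map gaps_above_inversions_map satisfying_split)+

theorem mainTheorem1:
  fixes n :: nat
  assumes "n \<ge> 1"
  shows "card {p \<in> permutations_of_set {1..n}. satisfying_3_5_2_4_1 p} =
         card {p \<in> permutations_of_set {1..n}. avoiding_31_4_2 p}"
proof -
  have "card {p \<in> permutations_of_set {1..n}. satisfying_3_5_2_4_1 p} =
      count_with satisfying_3_5_2_4_1 gaps_above_inversions 0 n"
    using card_permutations_standardize[of "{1..n}" satisfying_3_5_2_4_1] satisfying_map
    by (simp add: count_with_def)
  also have "\<dots> = count_with avoiding_31_4_2 uncrossed_gaps 0 n"
    by (rule count_with_unique[OF split_at_max_satisfying split_at_max_avoiding])
  also have "\<dots> = card {p \<in> permutations_of_set {1..n}. avoiding_31_4_2 p}"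
    using card_permutations_standardize[of "{1..n}" avoiding_31_4_2] avoiding_map
    by (simp add: count_with_def)
  finally show ?thesis .
qed

end
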